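(* Let $(k_n)_{n\ge1}$ be a sequence of positive integers and $(d_n)_{n\ge1}$ a sequence of nonnegative real numbers for which $$\limsup_{n\to\infty}\frac1{k_n}\left(d_1+\cdots+d_{k_1+\cdots+k_n}\right)>0,$$ and let $D=\operatorname{diag}(d_n)$ relative to an orthonormal basis $(e_n)_{n\ge1}$ of $\mathcal H$. Then there do not exist a compact operator $C$ and a bounded operator $Z$ on $\mathcal H$ with $D=CZ-ZC$ such that, relative to the basis $(e_n)$ and the block partition with central block sizes $k_n\times k_n$, at least one of $C,Z$ is block tridiagonal.
   Context: $\mathcal H$ is an infinite dimensional separable complex Hilbert space. $\operatorname{diag}(d_n)$ is the operator with $De_n=d_ne_n$. Given block sizes $k_n$, put $s_0=0$, $s_n=k_1+\cdots+k_n$, and let $P_n$ be the orthogonal projection onto the span of $e_{s_{n-1}+1},\dots,e_{s_n}$. An operator $S$ is block tridiagonal (with central block sizes $k_n\times k_n$) if $P_iSP_j=0$ whenever $|i-j|>1$. *)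

theory Defs
  imports "HOL-Analysis.Analysis"
begin

text \<open>
  Complex inner product spaces are built on top of \<open>real_inner\<close>: a complex inner product
  space is a real one under the real part of its inner product, so that its norm is
  the usual one and the library's topology applies. The inner product is linear in
  its second argument.
\<close>

class complex_inner = real_inner +
  fixes scaleC :: "complex \<Rightarrow> 'a \<Rightarrow> 'a"  (infixr \<open>*\<^sub>C\<close> 75)
    and cinner :: "'a \<Rightarrow> 'a \<Rightarrow> complex"
  assumes scaleC_add_right: "a *\<^sub>C (x + y) = a *\<^sub>C x + a *\<^sub>C y"
    and scaleC_add_left: "(a + b) *\<^sub>C x = a *\<^sub>C x + b *\<^sub>C x"
    and scaleC_scaleC: "a *\<^sub>C (b *\<^sub>C x) = (a * b) *\<^sub>C x"
    and scaleC_of_real: "complex_of_real r *\<^sub>C x = r *\<^sub>R x"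
    and cinner_commute: "cinner x y = cnj (cinner y x)"
    and cinner_add_right: "cinner x (y + z) = cinner x y + cinner x z"
    and cinner_scaleC_right: "cinner x (a *\<^sub>C y) = a * cinner x y"
    and inner_eq_Re_cinner: "inner x y = Re (cinner x y)"

class chilbert_space = complex_inner + complete_space

lemma vector_space_scaleC:
  "vector_space (scaleC :: complex \<Rightarrow> 'a \<Rightarrow> 'a::complex_inner)"
proof
  fix x :: 'a
  show "1 *\<^sub>C x = x"
    using scaleC_of_real[of 1 x] by simp
qed (auto simp: scaleC_add_right scaleC_add_left scaleC_scaleC)

global_interpretation complex_vector: vector_space
  "scaleC :: complex \<Rightarrow> 'a \<Rightarrow> 'a::complex_inner"
  by (rule vector_space_scaleC)

definition clinear :: "('a::complex_inner \<Rightarrow> 'a) \<Rightarrow> bool" where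
  "clinear T \<longleftrightarrow> Vector_Spaces.linear scaleC scaleC T"

definition bounded_op :: "('a::complex_inner \<Rightarrow> 'a) \<Rightarrow> bool" where
  "bounded_op T \<longleftrightarrow> clinear T \<and> bounded_linear T"

definition compact_op :: "('a::complex_inner \<Rightarrow> 'a) \<Rightarrow> bool" where
  "compact_op T \<longleftrightarrow> clinear T \<and> compact (closure (T ` cball 0 1))"

definition orthonormal_seq :: "(nat \<Rightarrow> 'a::complex_inner) \<Rightarrow> bool" where
  "orthonormal_seq e \<longleftrightarrow> (\<forall>i j. cinner (e i) (e j) = (if i = j then 1 else 0))"

text \<open>
  A space carrying an orthonormal basis indexed by the natural numbers is
  infinite dimensional and separable.
\<close>

definition orthonormal_basis :: "(nat \<Rightarrow> 'a::complex_inner) \<Rightarrow> bool" where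
  "orthonormal_basis e \<longleftrightarrow>
     orthonormal_seq e \<and> closure (complex_vector.span (range e)) = UNIV"

text \<open>
  Boundedness is not built in (the diagonal sequence may be unbounded). Bounded operators
  are determined by their values on an orthonormal basis, so there is at most one bounded
  \<open>D\<close> with this property.
\<close>

definition is_diag :: "(nat \<Rightarrow> 'a::complex_inner) \<Rightarrow> (nat \<Rightarrow> real) \<Rightarrow> ('a \<Rightarrow> 'a) \<Rightarrow> bool" where
  "is_diag e d D \<longleftrightarrow> clinear D \<and> (\<forall>n. D (e n) = complex_of_real (d n) *\<^sub>C e n)"

definition orth_proj :: "'a::complex_inner set \<Rightarrow> 'a \<Rightarrow> 'a" where
  "orth_proj M x = (THE y. y \<in> M \<and> (\<forall>z\<in>M. cinner z (x - y) = 0))"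

text \<open>
  All sequences start at index 0: block \<open>n\<close> has size \<open>k n\<close> and consists of the basis vectors
  with indices \<open>block_start k n, \<dots>, block_start k (Suc n) - 1\<close>.
\<close>

definition block_start :: "(nat \<Rightarrow> nat) \<Rightarrow> nat \<Rightarrow> nat" where
  "block_start k n = (\<Sum>i<n. k i)"

definition block_proj :: "(nat \<Rightarrow> 'a::complex_inner) \<Rightarrow> (nat \<Rightarrow> nat) \<Rightarrow> nat \<Rightarrow> 'a \<Rightarrow> 'a" where
  "block_proj e k n =
     orth_proj (complex_vector.span (e ` {block_start k n..<block_start k (Suc n)}))"

definition block_tridiagonal ::
    "(nat \<Rightarrow> 'a::complex_inner) \<Rightarrow> (nat \<Rightarrow> nat) \<Rightarrow> ('a \<Rightarrow> 'a) \<Rightarrow> bool" where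
  "block_tridiagonal e k S \<longleftrightarrow>
     (\<forall>i j. \<bar>int i - int j\<bar> > 1 \<longrightarrow> block_proj e k i \<circ> S \<circ> block_proj e k j = (\<lambda>x. 0))"

lemma cinner_zero_right [simp]: "cinner x 0 = 0" for x :: "'a::complex_inner"
  using cinner_add_right[of x 0 0] by simp

lemma cinner_diff_right: "cinner x (y - z) = cinner x y - cinner x z"
  for x :: "'a::complex_inner"
  using cinner_add_right[of x "y - z" z] by simp

lemma cinner_sum_right: "cinner x (\<Sum>i\<in>A. f i) = (\<Sum>i\<in>A. cinner x (f i))"
  for x :: "'a::complex_inner"
  by (induction A rule: infinite_finite_induct) (auto simp: cinner_add_right)

lemma orth_proj_span_orthonormal:
  fixes e :: "nat \<Rightarrow> 'a::complex_inner"
  assumes e: "orthonormal_seq e" and A: "finite A"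
  shows "orth_proj (complex_vector.span (e ` A)) x = (\<Sum>i\<in>A. cinner (e i) x *\<^sub>C e i)"
    (is "orth_proj ?M x = ?p")
  unfolding orth_proj_def
proof (rule the_equality)
  have pM: "?p \<in> ?M"
    by (intro complex_vector.span_sum complex_vector.span_scale complex_vector.span_base) auto
  have orth: "cinner z (x - ?p) = 0" if "z \<in> ?M" for z
  proof -
    have base: "cinner (x - ?p) (e j) = 0" if "j \<in> A" for j
    proof -
      have "cinner (e j) ?p = (\<Sum>i\<in>A. if j = i then cinner (e i) x else 0)"
        unfolding cinner_sum_right cinner_scaleC_right
        using e by (intro sum.cong) (auto simp: orthonormal_seq_def)
      also have "\<dots> = cinner (e j) x"
        using that A by simp
      finally have "cinner (e j) (x - ?p) = 0"
        by (simp add: cinner_diff_right)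
      then show ?thesis
        by (metis cinner_commute complex_cnj_zero)
    qed
    from that have "cinner (x - ?p) z = 0"
      by (induction rule: complex_vector.span_induct_alt)
         (auto simp: cinner_add_right cinner_scaleC_right base)
    then show ?thesis
      by (metis cinner_commute complex_cnj_zero)
  qed
  show "?p \<in> ?M \<and> (\<forall>z\<in>?M. cinner z (x - ?p) = 0)"
    using pM orth by blast
  fix y
  assume y: "y \<in> ?M \<and> (\<forall>z\<in>?M. cinner z (x - y) = 0)"
  have M: "y - ?p \<in> ?M"
    using y pM by (intro complex_vector.span_diff) auto
  have "cinner (y - ?p) (y - ?p) = cinner (y - ?p) (x - ?p) - cinner (y - ?p) (x - y)"
    by (simp flip: cinner_diff_right)
  also have "\<dots> = 0"
    using y orth M by simp
  finally have "inner (y - ?p) (y - ?p) = 0"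
    by (simp add: inner_eq_Re_cinner)
  then show "y = ?p"
    by simp
qed

lemma block_proj_eq_sum:
  assumes "orthonormal_seq e"
  shows "block_proj e k n x =
    (\<Sum>i = block_start k n..<block_start k (Suc n). cinner (e i) x *\<^sub>C e i)"
  unfolding block_proj_def using assms by (intro orth_proj_span_orthonormal) auto

end

theory Submission
  imports Defs
begin

text \<open>
  Suppose \<open>D = CZ - ZC\<close> and write \<open>s\<close> for the index at which block \<open>n + 1\<close> starts.
  The sum \<open>\<Sum>i<s. d i\<close> is the trace of the top left \<open>s \<times> s\<close> corner
  of the commutator. With matrix entries \<open>c i j\<close> and \<open>z i j\<close>, row \<open>i\<close> contributes
  \<open>\<Sum>\<^sub>j a i j\<close>, where \<open>a i j = c i j * z j i - z i j * c j i\<close>. This array is antisymmetric,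
  so the terms with both \<open>i, j < s\<close> cancel. Each term contains a factor from \<open>C\<close> and
  a factor from \<open>Z\<close> at the position \<open>(i, j)\<close> or its mirror image, hence vanishes far from the
  block diagonal as soon as one of the two operators is block tridiagonal. What survives is
  the sum over \<open>i\<close> in block \<open>n\<close> and \<open>j\<close> in block \<open>n + 1\<close>
  (\<open>commutator_truncated_trace\<close>).

  With \<open>P\<close> the projection onto block \<open>n + 1\<close>, each of the \<open>k n\<close> surviving rows equals
  \<open>\<langle>e\<^sub>i, C P Z e\<^sub>i\<rangle> - \<langle>e\<^sub>i, Z P C e\<^sub>i\<rangle>\<close>. In the first term \<open>C\<close> acts on a vector
  supported on block \<open>n + 1\<close>, in the second on a basis vector of block \<open>n\<close>. A compact
  operator is uniformly small on vectors supported far out in the basis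
  (\<open>compact_op_small_on_tails\<close>), so every row is small, and the trace divided by \<open>k n\<close> tends
  to 0, which contradicts the positive limit superior.

  The smallness of \<open>C\<close> rests on the fact that a compact operator maps orthonormal sequences
  to null sequences (\<open>compact_image_orthonormal_null\<close>). It is obtained here by adding up many
  orthonormal vectors, which avoids adjoints and weak convergence.
\<close>

section \<open>Complex inner products\<close>

lemma cinner_add_left: "cinner (x + y) z = cinner x z + cinner y z"
  for x :: "'a::complex_inner"
  using cinner_commute[of "x + y" z] cinner_commute[of x z] cinner_commute[of y z]
  by (simp add: cinner_add_right)

lemma cinner_scaleC_left: "cinner (a *\<^sub>C x) z = cnj a * cinner x z"
  for x :: "'a::complex_inner"
  using cinner_commute[of "a *\<^sub>C x" z] cinner_commute[of x z]
  by (simp add: cinner_scaleC_right)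

lemma cinner_sum_left: "cinner (\<Sum>i\<in>A. f i) x = (\<Sum>i\<in>A. cinner (f i) x)"
  for x :: "'a::complex_inner"
proof -
  have "cinner 0 x = 0"
    using cinner_commute[of 0 x] by simp
  then show ?thesis
    by (induction A rule: infinite_finite_induct) (auto simp: cinner_add_left)
qed

lemma norm_scaleC: "norm (a *\<^sub>C x) = cmod a * norm x" for x :: "'a::complex_inner"
proof -
  have im: "Im (cinner x x) = 0"
    using arg_cong[OF cinner_commute[of x x], of Im] by simp
  have "(norm (a *\<^sub>C x))\<^sup>2 = Re (a * (cnj a * cinner x x))"
    by (simp only: power2_norm_eq_inner inner_eq_Re_cinner cinner_scaleC_left cinner_scaleC_right)
  also have "a * (cnj a * cinner x x) = complex_of_real ((cmod a)\<^sup>2) * cinner x x"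
    unfolding complex_norm_square by (simp add: mult_ac)
  also have "Re \<dots> = (cmod a * norm x)\<^sup>2"
    by (simp add: power_mult_distrib power2_norm_eq_inner inner_eq_Re_cinner im)
  finally show ?thesis
    by simp
qed

text \<open>
  The real Cauchy-Schwarz inequality bounds the real part; rotating \<open>y\<close> by a unimodular
  scalar makes the complex inner product real.
\<close>

lemma norm_cinner_le: "cmod (cinner x y) \<le> norm x * norm y" for x :: "'a::complex_inner"
proof (cases "cinner x y = 0")
  case False
  define u where "u = cnj (cinner x y) / complex_of_real (cmod (cinner x y))"
  have u: "cmod u = 1"
    using False by (simp add: u_def norm_divide)
  have "u * cinner x y = complex_of_real (cmod (cinner x y))"
    using False by (simp add: u_def mult.commute[of "cnj _"] flip: complex_norm_square)
                   (simp add: power2_eq_square)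
  then have "cmod (cinner x y) = inner x (u *\<^sub>C y)"
    by (simp add: inner_eq_Re_cinner cinner_scaleC_right)
  also have "\<dots> \<le> norm x * norm (u *\<^sub>C y)"
    by (rule norm_cauchy_schwarz)
  finally show ?thesis
    by (simp add: norm_scaleC u)
qed simp

lemma bounded_linear_cinner_right: "bounded_linear (cinner x)" for x :: "'a::complex_inner"
proof (rule bounded_linear_intro[where K = "norm x"])
  show "cinner x (r *\<^sub>R y) = r *\<^sub>R cinner x y" for r y
    by (simp add: cinner_scaleC_right scaleR_conv_of_real flip: scaleC_of_real)
qed (auto simp: cinner_add_right norm_cinner_le mult.commute[of _ "norm x"])

lemma clinear_add: "clinear T \<Longrightarrow> T (x + y) = T x + T y"
  and clinear_scaleC: "clinear T \<Longrightarrow> T (a *\<^sub>C x) = a *\<^sub>C T x"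
  by (simp_all add: clinear_def Vector_Spaces.linear_def module_hom_def module_hom_axioms_def)

lemma clinear_sum:
  assumes "clinear T"
  shows "T (\<Sum>i\<in>A. f i) = (\<Sum>i\<in>A. T (f i))"
proof -
  have "T 0 = 0"
    using clinear_add[OF assms, of 0 0] by simp
  then show ?thesis
    by (induction A rule: infinite_finite_induct) (auto simp: clinear_add[OF assms])
qed

lemma compact_op_imp_bounded_linear:
  assumes "compact_op C"
  shows "bounded_linear C"
proof -
  have lin: "clinear C" and "compact (closure (C ` cball 0 1))"
    using assms by (auto simp: compact_op_def)
  then have "bounded (C ` cball 0 1)"
    by (intro bounded_subset[OF compact_imp_bounded closure_subset])
  then obtain K where "\<forall>y\<in>C ` cball 0 1. norm y \<le> K"
    unfolding bounded_iff by blast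
  then have K: "norm (C x) \<le> K" if "norm x \<le> 1" for x
    using that by simp
  have scale: "C (r *\<^sub>R x) = r *\<^sub>R C x" for r x
    using clinear_scaleC[OF lin, of "complex_of_real r"] by (simp add: scaleC_of_real)
  show ?thesis
  proof (rule bounded_linear_intro[where K = K])
    show "C (x + y) = C x + C y" for x y
      by (rule clinear_add[OF lin])
    show "C (r *\<^sub>R x) = r *\<^sub>R C x" for r x
      by (rule scale)
    show "norm (C x) \<le> norm x * K" for x
    proof (cases "x = 0")
      case True
      then show ?thesis
        using scale[of 0 0] by simp
    next
      case False
      have "norm (C ((1 / norm x) *\<^sub>R x)) \<le> K"
        using False by (intro K) simp
      with False show ?thesis
        by (simp add: scale field_simps)
    qed
  qed
qed

section \<open>Coordinate projections and orthonormal expansions\<close>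

definition coord_proj :: "(nat \<Rightarrow> 'a::complex_inner) \<Rightarrow> nat set \<Rightarrow> 'a \<Rightarrow> 'a" where
  "coord_proj e A x = (\<Sum>i\<in>A. cinner (e i) x *\<^sub>C e i)"

lemma orthonormal_seq_norm: "orthonormal_seq e \<Longrightarrow> norm (e i) = 1"
  by (simp add: orthonormal_seq_def norm_eq_sqrt_inner inner_eq_Re_cinner)

lemma coord_proj_add: "coord_proj e A (x + y) = coord_proj e A x + coord_proj e A y"
  by (simp add: coord_proj_def cinner_add_right scaleC_add_left sum.distrib)

lemma coord_proj_scaleC: "coord_proj e A (a *\<^sub>C x) = a *\<^sub>C coord_proj e A x"
  by (simp add: coord_proj_def cinner_scaleC_right complex_vector.scale_sum_right)

lemma cinner_coord_proj:
  assumes "orthonormal_seq e" "finite A"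
  shows "cinner (e j) (coord_proj e A x) = (if j \<in> A then cinner (e j) x else 0)"
proof -
  have "cinner (e j) (coord_proj e A x) = (\<Sum>i\<in>A. if j = i then cinner (e i) x else 0)"
    unfolding coord_proj_def cinner_sum_right cinner_scaleC_right
    using assms(1) by (intro sum.cong) (auto simp: orthonormal_seq_def)
  then show ?thesis
    using assms(2) by simp
qed

lemma coord_proj_basis:
  assumes "orthonormal_seq e" "finite A" "j \<in> A"
  shows "coord_proj e A (e j) = e j"
proof -
  have "coord_proj e A (e j) = (\<Sum>i\<in>A. if i = j then e j else 0)"
    unfolding coord_proj_def
    using assms(1) by (intro sum.cong) (auto simp: orthonormal_seq_def)
  then show ?thesis
    using assms by simp
qed

lemma coord_proj_orthogonal:
  assumes "orthonormal_seq e" "finite B" "A \<inter> B = {}"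
  shows "inner (coord_proj e A x) (coord_proj e B y) = 0"
proof -
  have "cinner (coord_proj e A x) (coord_proj e B y) = 0"
    unfolding coord_proj_def[of e A] cinner_sum_left cinner_scaleC_left
    using assms by (intro sum.neutral) (auto simp: cinner_coord_proj)
  then show ?thesis
    by (simp add: inner_eq_Re_cinner)
qed

lemma coord_proj_pythagoras:
  assumes "orthonormal_seq e" "finite A"
  shows "(norm x)\<^sup>2 = (norm (coord_proj e A x))\<^sup>2 + (norm (x - coord_proj e A x))\<^sup>2"
proof -
  let ?p = "coord_proj e A x"
  have "cinner ?p y = (\<Sum>i\<in>A. cnj (cinner (e i) x) * cinner (e i) y)" for y
    by (simp add: coord_proj_def cinner_sum_left cinner_scaleC_left)
  then have "cinner ?p (x - ?p) = 0"
    using assms by (simp add: cinner_diff_right cinner_coord_proj)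
  then have "inner ?p (x - ?p) = 0"
    by (simp add: inner_eq_Re_cinner)
  then show ?thesis
    using norm_add_Pythagorean[of ?p "x - ?p"] by (simp add: orthogonal_def)
qed

lemma norm_coord_proj_le:
  assumes "orthonormal_seq e" "finite A"
  shows "norm (coord_proj e A x) \<le> norm x" "norm (x - coord_proj e A x) \<le> norm x"
  using coord_proj_pythagoras[OF assms, of x] by (auto intro: power2_le_imp_le[OF _ norm_ge_zero])

text \<open>
  A vector of the algebraic span involves only finitely many basis vectors, so long partial
  expansions leave it unchanged.
\<close>

lemma coord_proj_eventually_fixes_span:
  assumes e: "orthonormal_seq e" and y: "y \<in> complex_vector.span (range e)"
  shows "\<forall>\<^sub>F n in sequentially. coord_proj e {..<n} y = y"
  using y
proof (induction rule: complex_vector.span_induct_alt)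
  case base
  then show ?case
    by (simp add: coord_proj_def)
next
  case (step c x y)
  then obtain j where j: "x = e j"
    by blast
  show ?case
    using step.IH eventually_gt_at_top[of j]
    by eventually_elim (simp add: j coord_proj_add coord_proj_scaleC coord_proj_basis[OF e])
qed

text \<open>
  Partial expansions reproduce the dense span exactly from some point on, and the error
  maps \<open>x \<mapsto> x - coord_proj e {..<n} x\<close> are contractions, so the error tends to 0 everywhere.
\<close>

lemma orthonormal_expansion_sums:
  assumes e: "orthonormal_basis e"
  shows "(\<lambda>i. cinner (e i) x *\<^sub>C e i) sums x"
proof -
  have on: "orthonormal_seq e" and dense: "x \<in> closure (complex_vector.span (range e))"
    using e by (auto simp: orthonormal_basis_def)
  have "(\<lambda>n. coord_proj e {..<n} x) \<longlonglongrightarrow> x"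
  proof (rule tendstoI)
    fix r :: real
    assume "r > 0"
    with dense obtain y where y: "y \<in> complex_vector.span (range e)" "dist y x < r"
      by (auto simp: closure_approachable)
    show "\<forall>\<^sub>F n in sequentially. dist (coord_proj e {..<n} x) x < r"
      using coord_proj_eventually_fixes_span[OF on y(1)]
    proof eventually_elim
      case (elim n)
      have "coord_proj e {..<n} x = coord_proj e {..<n} (x - y) + y"
        using elim coord_proj_add[of e "{..<n}" "x - y" y] by simp
      then have "dist (coord_proj e {..<n} x) x
          = norm ((x - y) - coord_proj e {..<n} (x - y))"
        by (simp add: dist_norm norm_minus_commute algebra_simps)
      also have "\<dots> \<le> norm (x - y)"
        by (rule norm_coord_proj_le[OF on]) simp
      finally show ?case
        using y(2) by (simp add: dist_norm norm_minus_commute)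
    qed
  qed
  then show ?thesis
    by (simp add: sums_def coord_proj_def)
qed

text \<open>
  For \<open>y = e i\<close> and \<open>v = S (e i)\<close> this is the formula for a diagonal entry of the matrix
  product of \<open>T\<close> and \<open>S\<close>; continuity of \<open>T\<close> carries the expansion of \<open>v\<close> through.
\<close>

lemma matrix_entry_expansion:
  assumes e: "orthonormal_basis e" and T: "clinear T" "bounded_linear T"
  shows "(\<lambda>j. cinner y (T (e j)) * cinner (e j) v) sums cinner y (T v)"
proof -
  have "(\<lambda>j. cinner y (T (cinner (e j) v *\<^sub>C e j))) sums cinner y (T v)"
    by (rule bounded_linear.sums[OF bounded_linear_cinner_right],
        rule bounded_linear.sums[OF T(2)], rule orthonormal_expansion_sums[OF e])
  then show ?thesis
    by (simp add: clinear_scaleC[OF T(1)] cinner_scaleC_right mult.commute[of "cinner (e _) v"])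
qed

lemma cinner_coord_proj_expand:
  assumes "clinear T"
  shows "cinner y (T (coord_proj e A v)) = (\<Sum>j\<in>A. cinner y (T (e j)) * cinner (e j) v)"
  by (simp only: coord_proj_def clinear_sum[OF assms] clinear_scaleC[OF assms]
        cinner_sum_right cinner_scaleC_right mult.commute[of "cinner (e _) v"])

section \<open>Compact operators are small far out in the basis\<close>

text \<open>
  Otherwise a subsequence \<open>w\<close> has images converging to some \<open>y \<noteq> 0\<close>. The sum of \<open>m\<close> of these
  orthonormal vectors has norm \<open>sqrt m\<close>, but its image is roughly \<open>m\<close> times \<open>y\<close>. The images
  of such sums grow linearly in \<open>m\<close> while a bounded operator permits only growth of order
  \<open>sqrt m\<close>.
\<close>

lemma compact_image_orthonormal_null:
  fixes f :: "'a::real_inner \<Rightarrow> 'b::real_normed_vector"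
  assumes f: "bounded_linear f" and K: "compact (closure (f ` cball 0 1))"
    and u: "\<And>i j. inner (u i) (u j) = (if i = j then 1 else 0)"
  shows "(\<lambda>n::nat. f (u n)) \<longlonglongrightarrow> 0"
proof (rule ccontr)
  assume "\<not> ?thesis"
  then obtain r where r: "r > 0" and "\<exists>\<^sub>F n in sequentially. r \<le> norm (f (u n))"
    by (auto simp: tendsto_iff not_eventually not_less)
  then have "infinite {n. r \<le> norm (f (u n))}"
    by (simp add: cofinite_eq_sequentially[symmetric] frequently_cofinite)
  then obtain p :: "nat \<Rightarrow> nat" where p: "strict_mono p" "\<And>n. r \<le> norm (f (u (p n)))"
    using infinite_enumerate by blast
  have "norm (u n) = 1" for n
    by (simp add: norm_eq_sqrt_inner u)
  then have "f (u (p n)) \<in> closure (f ` cball 0 1)" for n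
    by (intro subsetD[OF closure_subset] imageI) simp
  then obtain q y where q: "strict_mono q" "((\<lambda>n. f (u (p n))) \<circ> q) \<longlonglongrightarrow> y"
    using compact_imp_seq_compact[OF K] by (fastforce simp: seq_compact_def)
  define w where "w n = u (p (q n))" for n
  have w: "inner (w i) (w j) = (if i = j then 1 else 0)" for i j
    using p(1) q(1) by (simp add: w_def u strict_mono_eq)
  have lim: "(\<lambda>n. f (w n)) \<longlonglongrightarrow> y"
    using q(2) by (simp add: w_def o_def)
  have y: "norm y \<ge> r"
    by (rule LIMSEQ_le_const[OF tendsto_norm[OF lim]]) (use p(2) in \<open>auto simp: w_def\<close>)
  from lim r obtain n0 where n0: "\<And>n. n \<ge> n0 \<Longrightarrow> norm (f (w n) - y) < r / 2"
    using LIMSEQ_D[of _ y "r / 2"] by fastforce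
  obtain B where B: "\<And>x. norm (f x) \<le> norm x * B"
    using bounded_linear.bounded[OF f] by blast
  have bound: "real m \<le> (2 * B / r)\<^sup>2" if "m > 0" for m
  proof -
    define I where "I = {n0..<n0 + m}"
    have "(norm (\<Sum>i\<in>I. w i))\<^sup>2 = (\<Sum>i\<in>I. (norm (w i))\<^sup>2)"
      by (rule norm_sum_Pythagorean)
         (auto simp: I_def pairwise_def orthogonal_def w)
    also have "\<dots> = real m"
      by (simp add: I_def power2_norm_eq_inner w)
    finally have norm_w: "norm (\<Sum>i\<in>I. w i) = sqrt (real m)"
      by (metis norm_ge_zero real_sqrt_abs abs_of_nonneg)
    \<comment> \<open>The deviations from \<open>y\<close> add up to at most half of the main term \<open>m * norm y\<close>.\<close>
    have "real m *\<^sub>R y = f (\<Sum>i\<in>I. w i) - (\<Sum>i\<in>I. f (w i) - y)"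
      by (simp add: I_def bounded_linear.linear[OF f] linear_sum sum_subtractf sum_constant_scaleR)
    then have "real m * norm y \<le> norm (f (\<Sum>i\<in>I. w i)) + norm (\<Sum>i\<in>I. f (w i) - y)"
      by (metis norm_scaleR norm_triangle_ineq4 abs_of_nat)
    also have "norm (\<Sum>i\<in>I. f (w i) - y) \<le> real (card I) * (r / 2)"
      by (rule sum_norm_bound) (use n0 in \<open>force simp: I_def\<close>)
    also have "norm (f (\<Sum>i\<in>I. w i)) \<le> sqrt (real m) * B"
      using B[of "\<Sum>i\<in>I. w i"] by (simp add: norm_w)
    finally have "real m * norm y \<le> sqrt (real m) * B + real m * (r / 2)"
      by (simp add: I_def)
    moreover have "real m * r \<le> real m * norm y"
      using y by (intro mult_left_mono) auto
    ultimately have "sqrt (real m) * (sqrt (real m) * r) \<le> sqrt (real m) * (2 * B)"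
      by (simp add: mult.assoc[symmetric])
    then have "sqrt (real m) * r \<le> 2 * B"
      by (rule mult_left_le_imp_le) (use that in simp)
    then have "sqrt (real m) \<le> 2 * B / r"
      using r by (simp add: pos_le_divide_eq)
    then have "(sqrt (real m))\<^sup>2 \<le> (2 * B / r)\<^sup>2"
      by (intro power_mono) auto
    then show ?thesis
      by simp
  qed
  obtain m :: nat where m: "(2 * B / r)\<^sup>2 < real m"
    using reals_Archimedean2 by blast
  then have "0 < real m"
    by (rule le_less_trans[OF zero_le_power2])
  with bound[of m] m show False
    by simp
qed

text \<open>
  A failure for every \<open>N\<close> gives, arbitrarily far out, finitely supported vectors on which \<open>C\<close>
  is not small. Choosing them with disjoint supports and normalizing them yields an
  orthonormal sequence whose images stay away from 0.
\<close>

lemma compact_op_small_on_tails: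
  assumes e: "orthonormal_seq e" and C: "compact_op C" and r: "r > 0"
  shows "\<exists>N. \<forall>A x. finite A \<longrightarrow> A \<subseteq> {N..} \<longrightarrow> norm (C (coord_proj e A x)) \<le> r * norm x"
proof (rule ccontr)
  note lin = compact_op_imp_bounded_linear[OF C]
  assume "\<not> ?thesis"
  then have "\<exists>A x. finite A \<and> A \<subseteq> {N..} \<and> r * norm x < norm (C (coord_proj e A x))" for N
    by (auto simp: not_le)
  then obtain A x where A: "\<And>N. finite (A N)" "\<And>N. A N \<subseteq> {N..}"
    and x: "\<And>N. r * norm (x N) < norm (C (coord_proj e (A N) (x N)))"
    by metis
  define v where "v N = coord_proj e (A N) (x N)" for N
  have v: "r * norm (v N) < norm (C (v N))" for N
    using mult_left_mono[OF norm_coord_proj_le(1)[OF e A(1)[of N], of "x N"], of r] x[of N] r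
    unfolding v_def by linarith
  have "\<exists>M. \<forall>i\<in>A N. i < M" for N
    using A(1)[of N] by (auto simp: finite_nat_set_iff_bounded)
  then obtain M where M: "\<And>N i. i \<in> A N \<Longrightarrow> i < M N"
    by metis
  \<comment> \<open>Restarting beyond the support just used makes the supports of the chosen vectors disjoint;
    the maximum with the successor makes the monotonicity of \<open>p\<close> immediate.\<close>
  define p where "p n = ((\<lambda>N. max (Suc N) (M N)) ^^ n) 0" for n
  have p_Suc: "p (Suc n) = max (Suc (p n)) (M (p n))" for n
    by (simp add: p_def)
  have p_mono: "mono p"
    by (rule incseq_SucI) (simp add: p_Suc)
  have disj: "A (p i) \<inter> A (p j) = {}" if "i < j" for i j
  proof -
    have "M (p i) \<le> p j"
      using monoD[OF p_mono, of "Suc i" j] that by (simp add: p_Suc)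
    then show ?thesis
      using M[of _ "p i"] A(2)[of "p j"] by fastforce
  qed
  define u where "u n = v (p n) /\<^sub>R norm (v (p n))" for n
  have v_nz: "v N \<noteq> 0" for N
    using v[of N] linear_0[OF bounded_linear.linear[OF lin]] by auto
  have "inner (u i) (u j) = (if i = j then 1 else 0)" for i j
  proof (cases "i = j")
    case True
    then show ?thesis
      using v_nz[of "p j"] by (simp add: u_def dot_square_norm power2_eq_square)
  next
    case False
    then have "A (p i) \<inter> A (p j) = {}"
      using disj[of i j] disj[of j i] by (cases i j rule: linorder_cases) auto
    with False show ?thesis
      by (simp add: u_def v_def coord_proj_orthogonal[OF e A(1)])
  qed
  then have "(\<lambda>n. C (u n)) \<longlonglongrightarrow> 0"
    using C by (intro compact_image_orthonormal_null lin) (auto simp: compact_op_def)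
  then obtain n where "norm (C (u n)) < r"
    using LIMSEQ_D[OF _ r] by fastforce
  moreover have "norm (C (u n)) > r"
    using v[of "p n"] v_nz[of "p n"]
    by (simp add: u_def linear_scale[OF bounded_linear.linear[OF lin]] field_simps)
  ultimately show False
    by simp
qed

section \<open>Block tridiagonal matrices\<close>

lemma block_start_Suc: "block_start k (Suc n) = block_start k n + k n"
  by (simp add: block_start_def)

lemma block_start_mono: "m \<le> n \<Longrightarrow> block_start k m \<le> block_start k n"
  unfolding block_start_def by (intro sum_mono2) auto

lemma le_block_start:
  assumes k: "\<And>n. k n > 0"
  shows "n \<le> block_start k n"
proof (induction n)
  case (Suc n)
  then show ?case
    using k[of n] by (simp add: block_start_Suc)
qed simp

lemma index_in_block:
  assumes "i < block_start k n"
  obtains m where "m < n" "i \<in> {block_start k m..<block_start k (Suc m)}"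
  using assms
proof (induction n arbitrary: thesis)
  case (Suc n)
  show ?case
  proof (cases "i < block_start k n")
    case True
    then show ?thesis
      using Suc.IH Suc.prems(1) less_SucI by blast
  next
    case False
    then show ?thesis
      using Suc.prems by (intro Suc.prems(1)[of n]) auto
  qed
qed (simp add: block_start_def)

lemma block_tridiagonal_entry_eq_0:
  assumes e: "orthonormal_seq e" and S: "block_tridiagonal e k S" and far: "\<bar>int m - int l\<bar> > 1"
    and a: "a \<in> {block_start k m..<block_start k (Suc m)}"
    and b: "b \<in> {block_start k l..<block_start k (Suc l)}"
  shows "cinner (e a) (S (e b)) = 0"
proof -
  have P: "block_proj e k n = coord_proj e {block_start k n..<block_start k (Suc n)}" for n
    by (simp add: block_proj_eq_sum[OF e] coord_proj_def fun_eq_iff)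
  have "(block_proj e k m \<circ> S \<circ> block_proj e k l) (e b) = 0"
    using S far unfolding block_tridiagonal_def by metis
  then have "coord_proj e {block_start k m..<block_start k (Suc m)} (S (e b)) = 0"
    using coord_proj_basis[OF e _ b] by (simp add: P)
  then show ?thesis
    using cinner_coord_proj[OF e, of "{block_start k m..<block_start k (Suc m)}" a "S (e b)"] a
    by simp
qed

text \<open>
  Indices below the start of block \<open>n\<close> lie in blocks before \<open>n\<close>, and indices from the end of
  block \<open>n\<close> onwards lie in blocks after \<open>n\<close>, because nonempty blocks exhaust all
  indices. Such blocks are at least two apart.
\<close>

lemma block_tridiagonal_corner_eq_0:
  assumes e: "orthonormal_seq e" and k: "\<And>n. k n > 0" and S: "block_tridiagonal e k S"
    and i: "i < block_start k n" and j: "block_start k (Suc n) \<le> j"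
  shows "cinner (e i) (S (e j)) = 0" "cinner (e j) (S (e i)) = 0"
proof -
  obtain m where m: "m < n" "i \<in> {block_start k m..<block_start k (Suc m)}"
    using index_in_block[OF i] .
  have "j < block_start k (Suc j)"
    using le_block_start[of k "Suc j"] k by (simp add: Suc_le_eq)
  then obtain l where l: "j \<in> {block_start k l..<block_start k (Suc l)}"
    using index_in_block by metis
  have "Suc n \<le> l"
    using block_start_mono[of "Suc l" "Suc n" k] l j
    by (cases "l \<le> n") auto
  with m(1) have far: "\<bar>int m - int l\<bar> > 1" "\<bar>int l - int m\<bar> > 1"
    by auto
  show "cinner (e i) (S (e j)) = 0" "cinner (e j) (S (e i)) = 0"
    using block_tridiagonal_entry_eq_0[OF e S far(1) m(2) l]
      block_tridiagonal_entry_eq_0[OF e S far(2) l m(2)] by auto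
qed

section \<open>Truncated traces of commutators\<close>

lemma sum_antisymmetric_square_eq_0:
  fixes a :: "'i \<Rightarrow> 'i \<Rightarrow> 'b::{idom,ring_char_0}"
  assumes "\<And>i j. a j i = - a i j"
  shows "(\<Sum>i\<in>A. \<Sum>j\<in>A. a i j) = 0"
proof -
  have "(\<Sum>i\<in>A. \<Sum>j\<in>A. a i j) = (\<Sum>i\<in>A. \<Sum>j\<in>A. - a i j)"
    by (subst sum.swap) (simp add: assms[symmetric])
  then show ?thesis
    by (simp add: sum_negf eq_neg_iff_add_eq_0 flip: mult_2)
qed

text \<open>
  In finite dimensions a commutator has trace 0. The trace of a corner of an infinite
  commutator is instead the flow across the cut between the blocks \<open>n\<close> and \<open>n + 1\<close>. Tridiagonality of one operator
  suffices because in every product one factor comes from each operator, and it makes all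
  row sums finite, so that they may be rearranged.
\<close>

lemma commutator_truncated_trace:
  assumes e: "orthonormal_basis e" and k: "\<And>n. k n > 0"
    and C: "clinear C" "bounded_linear C" and Z: "clinear Z" "bounded_linear Z"
    and tri: "block_tridiagonal e k C \<or> block_tridiagonal e k Z"
  defines "B \<equiv> \<lambda>n. {block_start k n..<block_start k (Suc n)}"
  shows "(\<Sum>i<block_start k (Suc n). cinner (e i) (C (Z (e i)) - Z (C (e i)))) =
    (\<Sum>i\<in>B n. cinner (e i) (C (coord_proj e (B (Suc n)) (Z (e i))))
              - cinner (e i) (Z (coord_proj e (B (Suc n)) (C (e i)))))"
proof -
  have on: "orthonormal_seq e"
    using e by (simp add: orthonormal_basis_def)
  define a where "a i j = cinner (e i) (C (e j)) * cinner (e j) (Z (e i))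
    - cinner (e i) (Z (e j)) * cinner (e j) (C (e i))" for i j
  have anti: "a j i = - a i j" for i j
    by (simp add: a_def)
  have corner: "a i j = 0" if "i < block_start k m" "block_start k (Suc m) \<le> j" for i j m
    using tri block_tridiagonal_corner_eq_0[OF on k _ that] by (auto simp: a_def)
  define s where "s = block_start k n"
  define s' where "s' = block_start k (Suc n)"
  define s'' where "s'' = block_start k (Suc (Suc n))"
  have s: "s \<le> s'" "s' \<le> s''"
    by (simp_all add: s_def s'_def s''_def block_start_mono)
  have row: "cinner (e i) (C (Z (e i)) - Z (C (e i))) = (\<Sum>j<s''. a i j)" if "i < s'" for i
  proof -
    have "a i sums cinner (e i) (C (Z (e i)) - Z (C (e i)))"
      unfolding a_def cinner_diff_right
      by (intro sums_diff matrix_entry_expansion e C Z)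
    moreover have "a i sums (\<Sum>j<s''. a i j)"
      using corner[of i "Suc n"] that by (intro sums_finite) (auto simp: s'_def s''_def)
    ultimately show ?thesis
      by (rule sums_unique2)
  qed
  \<comment> \<open>The square \<open>i, j < s'\<close> cancels by antisymmetry; of the strip to its right, only the rows
    of block \<open>n\<close> can reach block \<open>n + 1\<close>.\<close>
  have "(\<Sum>i<s'. cinner (e i) (C (Z (e i)) - Z (C (e i)))) = (\<Sum>i<s'. \<Sum>j<s''. a i j)"
    by (intro sum.cong row) auto
  also have "\<dots> = (\<Sum>i<s'. (\<Sum>j<s'. a i j) + (\<Sum>j=s'..<s''. a i j))"
    using s(2) by (simp add: sum.atLeastLessThan_concat flip: atLeast0LessThan)
  also have "\<dots> = (\<Sum>i<s'. \<Sum>j=s'..<s''. a i j)"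
    using sum_antisymmetric_square_eq_0[of a "{..<s'}", OF anti] by (simp add: sum.distrib)
  also have "\<dots> = (\<Sum>i=s..<s'. \<Sum>j=s'..<s''. a i j)"
    using corner[of _ n]
    by (intro sum.mono_neutral_right) (auto simp: s_def s'_def intro!: sum.neutral)
  finally show ?thesis
    by (simp add: a_def B_def s_def s'_def s''_def sum_subtractf
        cinner_coord_proj_expand[OF C(1)] cinner_coord_proj_expand[OF Z(1)])
qed

text \<open>
  Only the \<open>k n\<close> rows of block \<open>n\<close> remain in the truncated trace, and in each of them \<open>C\<close>
  acts on a vector supported in the blocks \<open>n\<close> or \<open>n + 1\<close>, where it is small.
\<close>

lemma commutator_trace_average_tendsto_0:
  assumes e: "orthonormal_basis e" and k: "\<And>n. k n > 0"
    and C: "compact_op C" and Z: "bounded_op Z"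
    and tri: "block_tridiagonal e k C \<or> block_tridiagonal e k Z"
  shows "(\<lambda>n. (\<Sum>i<block_start k (Suc n). cinner (e i) (C (Z (e i)) - Z (C (e i))))
           / of_nat (k n)) \<longlonglongrightarrow> 0"
proof (rule LIMSEQ_I)
  fix r :: real
  assume r: "r > 0"
  have on: "orthonormal_seq e"
    using e by (simp add: orthonormal_basis_def)
  have Cl: "clinear C" "bounded_linear C"
    using C compact_op_imp_bounded_linear by (auto simp: compact_op_def)
  have Zl: "clinear Z" "bounded_linear Z"
    using Z by (auto simp: bounded_op_def)
  obtain K where K: "K > 0" "\<And>x. norm (Z x) \<le> norm x * K"
    using bounded_linear.pos_bounded[OF Zl(2)] by blast
  \<comment> \<open>A row contributes at most \<open>2 * t * K\<close>; the factor 3 makes this strictly less than \<open>r\<close>.\<close>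
  define t where "t = r / (3 * K)"
  have t: "t > 0"
    using r K by (simp add: t_def)
  obtain N where N: "\<And>A x. finite A \<Longrightarrow> A \<subseteq> {N..} \<Longrightarrow> norm (C (coord_proj e A x)) \<le> t * norm x"
    using compact_op_small_on_tails[OF on C t] by blast
  show "\<exists>no. \<forall>n\<ge>no. norm ((\<Sum>i<block_start k (Suc n).
      cinner (e i) (C (Z (e i)) - Z (C (e i)))) / of_nat (k n) - 0) < r"
  proof (intro exI allI impI)
    fix n
    assume n: "n \<ge> N"
    define B where "B n = {block_start k n..<block_start k (Suc n)}" for n
    have B: "B m \<subseteq> {N..}" "finite (B m)" if "m \<ge> n" for m
      using n that le_block_start[of k m] k by (auto simp: B_def intro: order_trans)
    let ?a = "\<lambda>i. cinner (e i) (C (coord_proj e (B (Suc n)) (Z (e i))))"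
    let ?b = "\<lambda>i. cinner (e i) (Z (coord_proj e (B (Suc n)) (C (e i))))"
    have unit: "norm (cinner (e i) x) \<le> norm x" for i x
      using norm_cinner_le[of "e i" x] by (simp add: orthonormal_seq_norm[OF on])
    have "norm (?a i - ?b i) \<le> 2 * t * K" if i: "i \<in> B n" for i
    proof -
      have "norm (?a i) \<le> t * norm (Z (e i))"
        by (rule order_trans[OF unit]) (intro N B; simp)
      also have "\<dots> \<le> t * K"
        using K(2)[of "e i"] t by (simp add: orthonormal_seq_norm[OF on])
      finally have a: "norm (?a i) \<le> t * K" .
      have "norm (?b i) \<le> norm (coord_proj e (B (Suc n)) (C (e i))) * K"
        by (rule order_trans[OF unit K(2)])
      also have "\<dots> \<le> norm (C (e i)) * K"
        using K(1) B(2) by (intro mult_right_mono norm_coord_proj_le on) auto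
      also have "norm (C (e i)) \<le> t"
      proof -
        have "i \<ge> N"
          using B(1)[of n] i by auto
        then show ?thesis
          using N[of "{i}" "e i"]
          by (simp add: coord_proj_basis[OF on] orthonormal_seq_norm[OF on])
      qed
      finally have "norm (?b i) \<le> t * K"
        using K(1) by simp
      with a show ?thesis
        using norm_triangle_ineq4[of "?a i" "?b i"] by simp
    qed
    then have "norm (\<Sum>i\<in>B n. ?a i - ?b i) \<le> real (card (B n)) * (2 * t * K)"
      by (rule sum_norm_bound)
    also have "\<dots> = real (k n) * (2 * r / 3)"
      using K(1) by (simp add: B_def block_start_Suc t_def)
    also have "\<dots> < real (k n) * r"
      using k[of n] r by simp
    finally show "norm ((\<Sum>i<block_start k (Suc n).
        cinner (e i) (C (Z (e i)) - Z (C (e i)))) / of_nat (k n) - 0) < r"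
      unfolding commutator_truncated_trace[where k = k, OF e k Cl Zl tri, folded B_def]
      using k[of n] by (simp add: norm_divide field_simps)
  qed
qed

theorem theorem3p4:
  fixes e :: "nat \<Rightarrow> 'a::chilbert_space"
    and k :: "nat \<Rightarrow> nat"
    and d :: "nat \<Rightarrow> real"
    and D :: "'a \<Rightarrow> 'a"
  assumes e: "orthonormal_basis e"
    and k: "\<And>n. k n > 0"
    and d: "\<And>n. d n \<ge> 0"
    and lim: "limsup (\<lambda>n. ereal (1 / real (k n) * (\<Sum>i<block_start k (Suc n). d i))) > 0"
    and D: "is_diag e d D"
  shows "\<not> (\<exists>C Z. compact_op C \<and> bounded_op Z \<and>
              D = (\<lambda>x. C (Z x) - Z (C x)) \<and>
              (block_tridiagonal e k C \<or> block_tridiagonal e k Z))"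
proof clarify
  fix C Z :: "'a \<Rightarrow> 'a"
  assume C: "compact_op C" and Z: "bounded_op Z" and eq: "D = (\<lambda>x. C (Z x) - Z (C x))"
    and tri: "block_tridiagonal e k C \<or> block_tridiagonal e k Z"
  have "cinner (e i) (D (e i)) = complex_of_real (d i)" for i
    using D e by (simp add: is_diag_def cinner_scaleC_right orthonormal_basis_def
        orthonormal_seq_def)
  then have "(\<lambda>n. complex_of_real (1 / real (k n) * (\<Sum>i<block_start k (Suc n). d i))) \<longlonglongrightarrow> 0"
    using commutator_trace_average_tendsto_0[where k = k, OF e k C Z tri] by (simp add: eq)
  then have "(\<lambda>n. 1 / real (k n) * (\<Sum>i<block_start k (Suc n). d i)) \<longlonglongrightarrow> 0"
    by (metis (no_types) of_real_0 tendsto_of_real_iff)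
  then have "limsup (\<lambda>n. ereal (1 / real (k n) * (\<Sum>i<block_start k (Suc n). d i))) = ereal 0"
    by (intro lim_imp_Limsup tendsto_ereal) auto
  with lim show False
    by (simp flip: zero_ereal_def)
qed

end
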